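(* Let $G$ be a finite, simple, connected vertex-transitive graph with at least two vertices, and let $r(G)=\min\{|R_G\{x,y\}| : x,y\in V(G),\ x\neq y\}$. Then $\dim_f(G)=\frac{|V(G)|}{r(G)}$.
   Context: $G$ is vertex-transitive if its full automorphism group acts transitively on $V(G)$. For vertices $x,y$ of $G$, $R_G\{x,y\}$ is the set of vertices $z$ with $d_G(x,z)\neq d_G(y,z)$, where $d_G$ is the graph distance. A resolving function of $G$ is a function $f:V(G)\to[0,1]$ with $f(R_G\{x,y\})\geq 1$ for all distinct $x,y\in V(G)$, where $f(W)=\sum_{v\in W}f(v)$. The fractional metric dimension $\dim_f(G)$ is the minimum of $f(V(G))$ over all resolving functions $f$ of $G$. *)

theory Defs
  imports "Graph_Theory.Graph_Theory"
begin

text \<open>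
  Simple undirected graphs are the symmetric, loop-free digraphs without parallel arcs of the
  library (locale \<^verbatim>\<open>graph\<close>): an edge is a pair of opposite arcs.
\<close>

text \<open>
  Every arc has weight 1, so the cost of a walk is its length. The value is an extended real
  because \<^verbatim>\<open>\<mu>\<close> is; it is infinite exactly when there is no walk.
\<close>

definition graph_dist :: "('a, 'b) pre_digraph \<Rightarrow> 'a \<Rightarrow> 'a \<Rightarrow> ereal" where
  "graph_dist G u v = wf_digraph.\<mu> G (\<lambda>_. 1) u v"

definition graph_automorphism ::
  "('a, 'b) pre_digraph \<Rightarrow> ('a, 'b, 'a, 'b) digraph_isomorphism \<Rightarrow> bool" where
  "graph_automorphism G h \<longleftrightarrow> pre_digraph.digraph_isomorphism G h \<and> app_iso h G = G"

definition vertex_transitive :: "('a, 'b) pre_digraph \<Rightarrow> bool" where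
  "vertex_transitive G \<longleftrightarrow>
    (\<forall>u\<in>verts G. \<forall>v\<in>verts G. \<exists>h. graph_automorphism G h \<and> iso_verts h u = v)"

definition resolving_set :: "('a, 'b) pre_digraph \<Rightarrow> 'a \<Rightarrow> 'a \<Rightarrow> 'a set" where
  "resolving_set G x y = {z \<in> verts G. graph_dist G x z \<noteq> graph_dist G y z}"

text \<open>Values of \<^verbatim>\<open>f\<close> outside the vertex set are irrelevant and left unconstrained.\<close>

definition resolving_function :: "('a, 'b) pre_digraph \<Rightarrow> ('a \<Rightarrow> real) \<Rightarrow> bool" where
  "resolving_function G f \<longleftrightarrow>
    (\<forall>v\<in>verts G. 0 \<le> f v \<and> f v \<le> 1) \<and>
    (\<forall>x\<in>verts G. \<forall>y\<in>verts G. x \<noteq> y \<longrightarrow> (\<Sum>v\<in>resolving_set G x y. f v) \<ge> 1)"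

text \<open>
  \<^verbatim>\<open>LEAST\<close> rather than \<^verbatim>\<open>Inf\<close>: an attained minimum is meant.
\<close>

definition frac_metric_dim :: "('a, 'b) pre_digraph \<Rightarrow> real" where
  "frac_metric_dim G = (LEAST s. \<exists>f. resolving_function G f \<and> s = (\<Sum>v\<in>verts G. f v))"

definition min_resolving_card :: "('a, 'b) pre_digraph \<Rightarrow> nat" where
  "min_resolving_card G =
    Min {card (resolving_set G x y) | x y. x \<in> verts G \<and> y \<in> verts G \<and> x \<noteq> y}"

end

theory Submission
  imports Defs "HOL-Combinatorics.Permutations"
begin

text \<open>
  The constant function $1 / r(G)$ is resolving. Conversely, summing the inequality
  $f(R\{\phi x, \phi y\}) \ge 1$ over all isometries $\phi$ of the graph distance, for a pair
  $x, y$ with $|R\{x, y\}| = r(G)$, spreads the mass of $f$ evenly by transitivity and yields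
  $r(G) \, f(V) \ge |V|$.
\<close>

text \<open>For fixed \<open>z\<close> in \<open>V\<close>, the sum of \<open>f (p z)\<close> over
  \<open>H\<close> is independent of \<open>z\<close>: if \<open>g\<close> in \<open>H\<close> takes
  \<open>w\<close> to \<open>z\<close>, then replacing \<open>p\<close> by
  \<open>p \<circ> g\<close> only reorders \<open>H\<close>. Comparing this common value
  \<open>S\<close> summed over \<open>V\<close> and over \<open>R\<close> gives the identity. It is
  stated with products, so no division by a cardinality occurs.\<close>

lemma sum_transitive_permutations:
  fixes f :: "'a \<Rightarrow> real"
  assumes fin: "finite V"
    and perm: "\<And>p. p \<in> H \<Longrightarrow> p permutes V"
    and comp: "\<And>p q. p \<in> H \<Longrightarrow> q \<in> H \<Longrightarrow> p \<circ> q \<in> H"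
    and trans: "\<And>u v. u \<in> V \<Longrightarrow> v \<in> V \<Longrightarrow> \<exists>p\<in>H. p u = v"
    and R: "R \<subseteq> V"
  shows "real (card V) * (\<Sum>p\<in>H. \<Sum>z\<in>R. f (p z)) = real (card R) * (real (card H) * sum f V)"
proof (cases "R = {}")
  case False
  \<comment> \<open>For empty \<open>R\<close> both sides vanish; otherwise \<open>R\<close>
    supplies a base point in \<open>V\<close>.\<close>
  then obtain w where w: "w \<in> V" using R by auto
  have finH: "finite H"
    by (rule finite_subset[OF _ finite_permutations[OF fin]]) (use perm in auto)
  define S where "S = (\<Sum>p\<in>H. f (p w))"
  have S: "(\<Sum>p\<in>H. f (p z)) = S" if "z \<in> V" for z
  proof -
    from trans[OF w that] obtain g where g: "g \<in> H" "g w = z" by blast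
    have inj: "inj_on (\<lambda>p. p \<circ> g) H"
    proof (rule inj_onI)
      fix p q assume "p \<circ> g = q \<circ> g"
      then show "p = q"
        using permutes_surj[OF perm[OF g(1)]] by (metis comp_assoc comp_id surj_iff)
    qed
    \<comment> \<open>An injective self-map of a finite set is onto, so right translation by
      \<open>g\<close> permutes \<open>H\<close> without an appeal to inverses.\<close>
    have "(\<lambda>p. p \<circ> g) ` H = H"
      using endo_inj_surj[OF finH _ inj] comp g by auto
    then have "S = (\<Sum>p\<in>H. f ((p \<circ> g) w))"
      unfolding S_def using sum.reindex[OF inj, of "\<lambda>p. f (p w)"] by simp
    then show ?thesis using g by simp
  qed
  have "real (card V) * S = (\<Sum>z\<in>V. \<Sum>p\<in>H. f (p z))"
    using S by simp
  also have "\<dots> = (\<Sum>p\<in>H. \<Sum>z\<in>V. f (p z))"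
    by (rule sum.swap)
  also have "\<dots> = (\<Sum>p\<in>H. sum f V)"
    by (rule sum.cong) (use sum.permute[OF perm, of _ f] in \<open>auto simp: o_def\<close>)
  finally have VS: "real (card V) * S = real (card H) * sum f V" by simp
  have "(\<Sum>p\<in>H. \<Sum>z\<in>R. f (p z)) = (\<Sum>z\<in>R. \<Sum>p\<in>H. f (p z))"
    by (rule sum.swap)
  also have "\<dots> = real (card R) * S"
    using S R by (simp add: subset_iff)
  finally show ?thesis using VS by simp
qed simp

lemma graph_automorphism_inv_iso:
  assumes "graph_automorphism G h"
  shows "graph_automorphism G (pre_digraph.inv_iso G h)"
proof -
  from assms have h: "pre_digraph.digraph_isomorphism G h" "app_iso h G = G"
    by (auto simp: graph_automorphism_def)
  then interpret wf_digraph G by (auto simp: pre_digraph.digraph_isomorphism_def)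
  show ?thesis
    using digraph_isomorphism_invI[OF h(1)] app_iso_inv[OF h(1)] h(2)
    by (auto simp: graph_automorphism_def)
qed

text \<open>An automorphism carries each walk from \<open>u\<close> to \<open>v\<close> to a walk of
  the same length between the images, so the infimum on the left also ranges over these
  images.\<close>

lemma graph_dist_automorphism_le:
  assumes "graph_automorphism G h"
  shows "graph_dist G (iso_verts h u) (iso_verts h v) \<le> graph_dist G u v"
proof -
  from assms have h: "pre_digraph.digraph_isomorphism G h" "app_iso h G = G"
    by (auto simp: graph_automorphism_def)
  then interpret wf_digraph G by (auto simp: pre_digraph.digraph_isomorphism_def)
  show ?thesis
    unfolding graph_dist_def \<mu>_def
  proof (rule INF_mono)
    fix p assume "p \<in> {p. awalk u p v}"
    then have "awalk (iso_verts h u) (map (iso_arcs h) p) (iso_verts h v)"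
      using awalk_app_isoI[OF _ h(1)] h(2) by auto
    then show "\<exists>q\<in>{q. awalk (iso_verts h u) q (iso_verts h v)}.
        ereal (awalk_cost (\<lambda>_. 1) q) \<le> ereal (awalk_cost (\<lambda>_. 1) p)"
      by (intro bexI[of _ "map (iso_arcs h) p"]) (auto simp: awalk_cost_def o_def)
  qed
qed

lemma graph_dist_automorphism:
  assumes h: "graph_automorphism G h" and uv: "u \<in> verts G" "v \<in> verts G"
  shows "graph_dist G (iso_verts h u) (iso_verts h v) = graph_dist G u v"
proof (rule antisym[OF graph_dist_automorphism_le[OF h]])
  have "pre_digraph.digraph_isomorphism G h"
    using h by (simp add: graph_automorphism_def)
  \<comment> \<open>The same inequality for the inverse automorphism, applied to the image
    vertices.\<close>
  then show "graph_dist G u v \<le> graph_dist G (iso_verts h u) (iso_verts h v)"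
    using graph_dist_automorphism_le[OF graph_automorphism_inv_iso[OF h],
        of "iso_verts h u" "iso_verts h v"] uv
    by (simp add: pre_digraph.iso_verts_inv_iso)
qed

text \<open>These stand in for automorphism records, whose vertex and arc maps are unconstrained off
  the graph. Since \<open>permutes\<close> fixes every point outside \<open>verts G\<close>, the set
  is finite for a finite graph and can be summed over.\<close>

definition isometries :: "('a, 'b) pre_digraph \<Rightarrow> ('a \<Rightarrow> 'a) set" where
  "isometries G = {p. p permutes verts G \<and>
    (\<forall>x\<in>verts G. \<forall>y\<in>verts G. graph_dist G (p x) (p y) = graph_dist G x y)}"

lemma isometries_comp:
  assumes "p \<in> isometries G" "q \<in> isometries G"
  shows "p \<circ> q \<in> isometries G"
  using assms by (auto simp: isometries_def permutes_in_image intro: permutes_compose)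

lemma isometries_transitive:
  assumes "vertex_transitive G" and u: "u \<in> verts G" and v: "v \<in> verts G"
  shows "\<exists>p\<in>isometries G. p u = v"
proof -
  obtain h where h: "graph_automorphism G h" and hu: "iso_verts h u = v"
    using assms by (auto simp: vertex_transitive_def)
  \<comment> \<open>The identity outside \<open>verts G\<close> is what \<open>permutes\<close>
    demands.\<close>
  define p where "p x = (if x \<in> verts G then iso_verts h x else x)" for x
  have inj: "inj_on (iso_verts h) (verts G)" and im: "iso_verts h ` verts G = verts G"
    using h verts_app_iso[of h G]
    by (auto simp: graph_automorphism_def pre_digraph.digraph_isomorphism_def simp del: verts_app_iso)
  have "bij_betw p (verts G) (verts G)"
    using inj im by (simp add: bij_betw_def p_def inj_on_def)
  then have "p permutes verts G"
    by (rule bij_imp_permutes) (simp add: p_def)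
  then have "p \<in> isometries G"
    using graph_dist_automorphism[OF h] by (simp add: isometries_def p_def)
  moreover have "p u = v" using hu u by (simp add: p_def)
  ultimately show ?thesis by blast
qed

lemma resolving_set_isometry:
  assumes p: "p \<in> isometries G" and xy: "x \<in> verts G" "y \<in> verts G"
  shows "resolving_set G (p x) (p y) = p ` resolving_set G x y"
proof -
  have im: "p ` verts G = verts G"
    using p by (auto simp: isometries_def permutes_image)
  have d: "graph_dist G (p a) (p b) = graph_dist G a b" if "a \<in> verts G" "b \<in> verts G" for a b
    using p that by (auto simp: isometries_def)
  have "resolving_set G (p x) (p y) =
      {z \<in> p ` verts G. graph_dist G (p x) z \<noteq> graph_dist G (p y) z}"
    by (simp add: resolving_set_def im)
  also have "\<dots> = p ` resolving_set G x y"
    using d xy by (auto simp: resolving_set_def)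
  finally show ?thesis .
qed

text \<open>The empty walk bounds the distance from \<open>x\<close> to itself by 0, while every
  walk from \<open>y\<close> to \<open>x\<close> has at least one arc. Hence resolving sets of
  distinct vertices are nonempty, which makes \<open>r\<close> positive.\<close>

lemma (in wf_digraph) mem_resolving_set:
  assumes "x \<in> verts G" "y \<in> verts G" "x \<noteq> y"
  shows "x \<in> resolving_set G x y"
proof -
  have "graph_dist G x x \<le> 0"
    unfolding graph_dist_def using min_cost_le_walk_cost[of x "[]" x "\<lambda>_. 1"] assms(1)
    by (simp add: awalk_Nil_iff zero_ereal_def)
  also have "(0 :: ereal) < 1" by simp
  also have "1 \<le> graph_dist G y x"
    unfolding graph_dist_def \<mu>_def
  proof (rule INF_greatest)
    fix p assume "p \<in> {p. awalk y p x}"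
    then have "p \<noteq> []" using assms(3) by (auto simp: awalk_Nil_iff)
    then show "1 \<le> ereal (awalk_cost (\<lambda>_. 1) p)"
      by (cases p) (auto simp: awalk_cost_def sum_list_triv)
  qed
  finally show ?thesis using assms(1) by (simp add: resolving_set_def)
qed

theorem theorem2p2:
  fixes G :: "('a, 'b) pre_digraph"
  assumes "graph G"
    and "Digraph_Component.connected G"
    and "vertex_transitive G"
    and "card (verts G) \<ge> 2"
  shows "frac_metric_dim G = real (card (verts G)) / real (min_resolving_card G)"
proof -
  interpret graph G by fact
  define C where "C = {card (resolving_set G x y) | x y. x \<in> verts G \<and> y \<in> verts G \<and> x \<noteq> y}"
  define r where "r = min_resolving_card G"
  have r: "r = Min C" by (simp add: r_def min_resolving_card_def C_def)
  have "C \<subseteq> (\<lambda>(x, y). card (resolving_set G x y)) ` (verts G \<times> verts G)"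
    by (auto simp: C_def)
  then have finC: "finite C" by (rule finite_subset) simp
  have finR: "finite (resolving_set G x y)" for x y by (simp add: resolving_set_def)
  \<comment> \<open>A pair of distinct vertices makes \<open>C\<close> nonempty, so that its
    \<open>Min\<close> is attained.\<close>
  have "\<exists>x\<in>verts G. \<exists>y\<in>verts G. x \<noteq> y"
    using assms(4) card_le_Suc0_iff_eq[of "verts G"] by auto
  then have "C \<noteq> {}" by (auto simp: C_def)
  then have "r \<in> C" using finC by (simp add: r)
  then obtain x y where xy: "x \<in> verts G" "y \<in> verts G" "x \<noteq> y"
    and rxy: "r = card (resolving_set G x y)" by (auto simp: C_def)
  have r_le: "r \<le> card (resolving_set G u v)" if "u \<in> verts G" "v \<in> verts G" "u \<noteq> v" for u v
    unfolding r by (rule Min_le[OF finC]) (use that in \<open>auto simp: C_def\<close>)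
  have r_pos: "r > 0"
    using mem_resolving_set[OF xy] finR by (auto simp: rxy card_gt_0_iff)
  have "frac_metric_dim G = real (card (verts G)) / real r"
    unfolding frac_metric_dim_def
  \<comment> \<open>Two goals: the quotient is the mass of some resolving function, and it bounds
    all such masses from below.\<close>
  proof (rule Least_equality)
    \<comment> \<open>The value is at most 1 because \<open>r\<close> is a positive integer, and
      every resolving set has at least \<open>r\<close> elements.\<close>
    have "resolving_function G (\<lambda>_. 1 / real r)"
      using r_pos r_le by (auto simp: resolving_function_def)
    then show "\<exists>f. resolving_function G f \<and> real (card (verts G)) / real r = sum f (verts G)"
      by (intro exI[of _ "\<lambda>_. 1 / real r"]) simp
  next
    fix s assume "\<exists>f. resolving_function G f \<and> s = sum f (verts G)"
    then obtain f where f: "resolving_function G f" and s: "s = sum f (verts G)" by auto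
    let ?H = "isometries G" and ?R = "resolving_set G x y"
    have perm: "p permutes verts G" if "p \<in> ?H" for p using that by (simp add: isometries_def)
    have finH: "finite ?H"
      by (rule finite_subset[OF _ finite_permutations[of "verts G"]]) (use perm in auto)
    have "?H \<noteq> {}" using isometries_transitive[OF assms(3) xy(1,2)] by auto
    then have H_pos: "card ?H > 0" using finH by (simp add: card_gt_0_iff)
    \<comment> \<open>This is the constraint on \<open>f\<close> at the pair \<open>p x\<close>,
      \<open>p y\<close>, pulled back along \<open>p\<close>: the resolving set of that pair is the
      image of \<open>?R\<close>.\<close>
    have ge1: "1 \<le> (\<Sum>z\<in>?R. f (p z))" if p: "p \<in> ?H" for p
    proof -
      have inj: "inj p" using perm[OF p] by (rule permutes_inj)
      have "p x \<in> verts G" "p y \<in> verts G" "p x \<noteq> p y"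
        using perm[OF p] xy inj by (auto simp: permutes_in_image dest: injD)
      then have "1 \<le> sum f (resolving_set G (p x) (p y))"
        using f by (simp add: resolving_function_def)
      then show ?thesis
        using sum.reindex[OF inj_on_subset[OF inj], of ?R f]
        by (simp add: resolving_set_isometry[OF p xy(1,2)])
    qed
    have "real (card ?H) \<le> (\<Sum>p\<in>?H. \<Sum>z\<in>?R. f (p z))"
      using sum_mono[of ?H "\<lambda>_. 1 :: real", OF ge1] by simp
    then have "real (card (verts G)) * real (card ?H)
        \<le> real (card (verts G)) * (\<Sum>p\<in>?H. \<Sum>z\<in>?R. f (p z))"
      by (rule mult_left_mono) simp
    also have "\<dots> = real r * (real (card ?H) * sum f (verts G))"
      unfolding rxy using perm isometries_comp isometries_transitive[OF assms(3)]
      by (intro sum_transitive_permutations) (auto simp: resolving_set_def)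
    finally have "real (card (verts G)) * real (card ?H) \<le> (s * real r) * real (card ?H)"
      by (simp add: s ac_simps)
    \<comment> \<open>The positive number of isometries cancels.\<close>
    then have "real (card (verts G)) \<le> s * real r" using H_pos by simp
    then show "real (card (verts G)) / real r \<le> s" using r_pos by (simp add: divide_le_eq)
  qed
  then show ?thesis by (simp add: r_def)
qed

end
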